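(* Let $\alpha,\beta\geq 0$ be real numbers with $\alpha+\beta\neq 0$, and let $a,b,p\in\mathbb{R}$ with $a<b$, $p>1$, $b\in\{a+k\alpha: k\in\mathbb{N}_0\}$ and $a\in\{b-k\beta: k\in\mathbb{N}_0\}$. Let $f,g:\mathbb{R}\to\mathbb{R}$. If $f$ and $g$ are $\alpha,\beta$-symmetric integrable on $[a,b]$, then $$\left(\int_{a}^{b}|f(t)+g(t)|^{p}\,d_{\alpha,\beta}t\right)^{1/p}\leq\left(\int_{a}^{b}|f(t)|^{p}\,d_{\alpha,\beta}t\right)^{1/p}+\left(\int_{a}^{b}|g(t)|^{p}\,d_{\alpha,\beta}t\right)^{1/p}.$$
   Context: $\mathbb{N}_0=\{0,1,2,\dots\}$. Let $h:\mathbb{R}\to\mathbb{R}$ and $a<b$ be reals. For $\alpha>0$, $h$ is $\alpha$-forward integrable on $[a,b]$ if the series $\int_x^{+\infty}h(t)\Delta_\alpha t:=\alpha\sum_{k=0}^{+\infty}h(x+k\alpha)$ converges for $x=a$ and $x=b$; then $\int_a^b h(t)\Delta_\alpha t:=\int_a^{+\infty}h(t)\Delta_\alpha t-\int_b^{+\infty}h(t)\Delta_\alpha t$. For $\beta>0$, $h$ is $\beta$-backward integrable on $[a,b]$ if the series $\int_{-\infty}^x h(t)\nabla_\beta t:=\beta\sum_{k=0}^{+\infty}h(x-k\beta)$ converges for $x=a$ and $x=b$; then $\int_a^b h(t)\nabla_\beta t:=\int_{-\infty}^b h(t)\nabla_\beta t-\int_{-\infty}^a h(t)\nabla_\beta t$.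 For $\alpha,\beta\ge 0$ with $\alpha+\beta>0$, $h$ is $\alpha,\beta$-symmetric integrable on $[a,b]$ if it is $\alpha$-forward integrable and $\beta$-backward integrable on $[a,b]$ (the forward requirement is dropped if $\alpha=0$, and the backward requirement is dropped if $\beta=0$); then $$\int_a^b h(t)\,d_{\alpha,\beta}t:=\frac{\alpha}{\alpha+\beta}\int_a^b h(t)\Delta_\alpha t+\frac{\beta}{\alpha+\beta}\int_a^b h(t)\nabla_\beta t,$$ where a term with zero coefficient is omitted.
   Formalization: It is additionally assumed that |f|^p and |g|^p are α,β-symmetric integrable on [a,b], which integrability of f and g does not imply (conditionally convergent series); integrability of |f+g|^p is then part of the conclusion. *)

theory Defs
  imports Complex_Main
begin

text \<open>
  The interval integrals below are only meaningful under the corresponding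
  integrability predicate: the library function \<^const>\<open>suminf\<close> returns an
  unspecified value on a divergent series.
\<close>

definition forward_tail :: "real \<Rightarrow> (real \<Rightarrow> real) \<Rightarrow> real \<Rightarrow> real" where
  "forward_tail \<alpha> h x = \<alpha> * (\<Sum>k. h (x + real k * \<alpha>))"

definition forward_integrable :: "real \<Rightarrow> (real \<Rightarrow> real) \<Rightarrow> real \<Rightarrow> real \<Rightarrow> bool" where
  "forward_integrable \<alpha> h a b \<longleftrightarrow>
     summable (\<lambda>k. h (a + real k * \<alpha>)) \<and> summable (\<lambda>k. h (b + real k * \<alpha>))"

definition forward_integral :: "real \<Rightarrow> (real \<Rightarrow> real) \<Rightarrow> real \<Rightarrow> real \<Rightarrow> real" where
  "forward_integral \<alpha> h a b = forward_tail \<alpha> h a - forward_tail \<alpha> h b"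

definition backward_tail :: "real \<Rightarrow> (real \<Rightarrow> real) \<Rightarrow> real \<Rightarrow> real" where
  "backward_tail \<beta> h x = \<beta> * (\<Sum>k. h (x - real k * \<beta>))"

definition backward_integrable :: "real \<Rightarrow> (real \<Rightarrow> real) \<Rightarrow> real \<Rightarrow> real \<Rightarrow> bool" where
  "backward_integrable \<beta> h a b \<longleftrightarrow>
     summable (\<lambda>k. h (a - real k * \<beta>)) \<and> summable (\<lambda>k. h (b - real k * \<beta>))"

definition backward_integral :: "real \<Rightarrow> (real \<Rightarrow> real) \<Rightarrow> real \<Rightarrow> real \<Rightarrow> real" where
  "backward_integral \<beta> h a b = backward_tail \<beta> h b - backward_tail \<beta> h a"

definition symmetric_integrable ::
    "real \<Rightarrow> real \<Rightarrow> (real \<Rightarrow> real) \<Rightarrow> real \<Rightarrow> real \<Rightarrow> bool" where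
  "symmetric_integrable \<alpha> \<beta> h a b \<longleftrightarrow>
     (\<alpha> \<noteq> 0 \<longrightarrow> forward_integrable \<alpha> h a b) \<and>
     (\<beta> \<noteq> 0 \<longrightarrow> backward_integrable \<beta> h a b)"

text \<open>
  Omitting a term with zero coefficient needs no case distinction, since such a
  term is a product with \<^term>\<open>0::real\<close>, whatever the value of the other factor.
\<close>

definition symmetric_integral ::
    "real \<Rightarrow> real \<Rightarrow> (real \<Rightarrow> real) \<Rightarrow> real \<Rightarrow> real \<Rightarrow> real" where
  "symmetric_integral \<alpha> \<beta> h a b =
     \<alpha> / (\<alpha> + \<beta>) * forward_integral \<alpha> h a b + \<beta> / (\<alpha> + \<beta>) * backward_integral \<beta> h a b"

end

theory Submission
  imports Defs "HOL-Analysis.Convex"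
begin

text \<open>
  Both tails defining the forward integral run along the same arithmetic progression, because
  \<open>b = a + m\<alpha>\<close>: all terms from \<open>b\<close> on cancel and \<open>\<alpha> (h a + h (a + \<alpha>) + \<dots> + h (b - \<alpha>))\<close>
  is left.  The backward integral collapses in the same way along \<open>b, b - \<beta>, b - 2\<beta>, \<dots>\<close>.  Hence
  on the integrable functions the symmetric integral is a finite sum with nonnegative weights, and
  the weights and nodes do not depend on the integrand
  (\<open>symmetric_integral_eq_weighted_sum\<close>).  The inequality is then Minkowski's inequality for such
  sums (\<open>weighted_sum_Minkowski\<close>), which follows from the convexity of \<open>x \<mapsto> x\<^sup>p\<close>.

  Integrability of \<open>\<bar>f + g\<bar>\<^sup>p\<close> is a matter of comparing series, using
  \<open>\<bar>u + v\<bar>\<^sup>p \<le> 2\<^sup>p (\<bar>u\<bar>\<^sup>p + \<bar>v\<bar>\<^sup>p)\<close>.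
\<close>

section \<open>Minkowski's inequality for finite weighted sums\<close>

lemma convex_on_powr_nonneg:
  fixes p :: real
  assumes "p \<ge> 1"
  shows "convex_on {0..} (\<lambda>x. x powr p)"
proof (rule convex_on_linorderI)
  fix t x y :: real
  assume t: "0 < t" "t < 1" and xy: "x \<in> {0..}" "y \<in> {0..}" "x < y"
  show "((1 - t) *\<^sub>R x + t *\<^sub>R y) powr p \<le> (1 - t) * x powr p + t * y powr p"
  proof (cases "x = 0")
    case True
    have "t powr p \<le> t powr 1"
      using t assms by (intro powr_mono') auto
    then have "t powr p * y powr p \<le> t * y powr p"
      using t by (intro mult_right_mono) auto
    then show ?thesis
      using True t xy by (simp add: powr_mult)
  next
    case False
    then show ?thesis
      using convex_onD[OF powr_convex[OF assms], of t x y] t xy by auto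
  qed
qed auto

text \<open>
  Convexity, applied to the point \<open>(u + v) / (A + B)\<close> as the convex combination of \<open>u / A\<close> and
  \<open>v / B\<close> with coefficients proportional to \<open>A\<close> and \<open>B\<close>.  When \<open>u\<^sup>p\<close> averages to \<open>A\<^sup>p\<close> and
  \<open>v\<^sup>p\<close> to \<open>B\<^sup>p\<close>, the right-hand side averages to \<open>(A + B)\<^sup>p\<close>; this is why Minkowski's
  inequality holds.
\<close>

lemma add_powr_le_weighted:
  fixes u v A B p :: real
  assumes "p \<ge> 1" "u \<ge> 0" "v \<ge> 0" "A > 0" "B > 0"
  shows "(u + v) powr p \<le> (A + B) powr p *
           (A / (A + B) * (u powr p / A powr p) + B / (A + B) * (v powr p / B powr p))"
proof -
  define s where "s = B / (A + B)"
  have s: "0 \<le> s" "s \<le> 1" "1 - s = A / (A + B)"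
    using assms by (auto simp: s_def field_simps)
  have comb: "(1 - s) * (u / A) + s * (v / B) = (u + v) / (A + B)"
    unfolding s(3) unfolding s_def using assms by (simp add: add_divide_distrib)
  have "((u + v) / (A + B)) powr p \<le> (1 - s) * (u / A) powr p + s * (v / B) powr p"
    using convex_onD[OF convex_on_powr_nonneg[OF assms(1)], of s "u / A" "v / B"] s(1,2) assms
    by (simp flip: comb)
  then have "(u + v) powr p / (A + B) powr p
      \<le> A / (A + B) * (u powr p / A powr p) + B / (A + B) * (v powr p / B powr p)"
    unfolding s(3) unfolding s_def using assms by (simp add: powr_divide)
  then show ?thesis
    using assms by (simp add: pos_divide_le_eq mult.commute)
qed

theorem weighted_sum_Minkowski:
  fixes w f g :: "'i \<Rightarrow> real" and p :: real
  assumes p: "p \<ge> 1" and w: "\<And>i. i \<in> I \<Longrightarrow> w i \<ge> 0"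
  shows "(\<Sum>i\<in>I. w i * \<bar>f i + g i\<bar> powr p) powr (1 / p)
         \<le> (\<Sum>i\<in>I. w i * \<bar>f i\<bar> powr p) powr (1 / p) + (\<Sum>i\<in>I. w i * \<bar>g i\<bar> powr p) powr (1 / p)"
proof (rule field_le_epsilon)
  fix e :: real
  assume e: "e > 0"
  define S where "S h = (\<Sum>i\<in>I. w i * \<bar>h i\<bar> powr p)" for h :: "'i \<Rightarrow> real"
  \<comment> \<open>The shift by \<open>e / 2\<close> makes both norms positive, so that they can be divided by even if
      \<open>f\<close> or \<open>g\<close> vanishes on the support of the weight.\<close>
  define A where "A = S f powr (1 / p) + e / 2"
  define B where "B = S g powr (1 / p) + e / 2"
  have A: "A > 0" and B: "B > 0"
    using e by (simp_all add: A_def B_def add_nonneg_pos)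
  have S_nonneg: "S h \<ge> 0" for h
    unfolding S_def using w by (intro sum_nonneg) auto
  have S_le: "S h \<le> (S h powr (1 / p) + e / 2) powr p" for h
  proof -
    have "S h = (S h powr (1 / p)) powr p"
      using S_nonneg p by (simp add: powr_powr)
    also have "\<dots> \<le> (S h powr (1 / p) + e / 2) powr p"
      using p e by (intro powr_mono2) auto
    finally show ?thesis .
  qed
  let ?c = "A / (A + B)" and ?d = "B / (A + B)"
  have "S (\<lambda>i. f i + g i) \<le> (\<Sum>i\<in>I. w i * ((A + B) powr p *
      (?c * (\<bar>f i\<bar> powr p / A powr p) + ?d * (\<bar>g i\<bar> powr p / B powr p))))"
    unfolding S_def
  proof (intro sum_mono mult_left_mono w)
    fix i
    have "\<bar>f i + g i\<bar> powr p \<le> (\<bar>f i\<bar> + \<bar>g i\<bar>) powr p"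
      using p by (intro powr_mono2) auto
    also have "\<dots> \<le> (A + B) powr p *
        (?c * (\<bar>f i\<bar> powr p / A powr p) + ?d * (\<bar>g i\<bar> powr p / B powr p))"
      using p A B by (intro add_powr_le_weighted) auto
    finally show "\<bar>f i + g i\<bar> powr p \<le> (A + B) powr p *
        (?c * (\<bar>f i\<bar> powr p / A powr p) + ?d * (\<bar>g i\<bar> powr p / B powr p))" .
  qed
  also have "\<dots> = (A + B) powr p * (?c * (S f / A powr p) + ?d * (S g / B powr p))"
    by (simp add: S_def sum_distrib_left sum_divide_distrib sum.distrib distrib_left mult_ac)
  also have "\<dots> \<le> (A + B) powr p * (?c * 1 + ?d * 1)"
    using A B S_le[of f] S_le[of g]
    by (intro mult_left_mono add_mono) (auto simp: A_def B_def)
  also have "?c * 1 + ?d * 1 = 1"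
    using A B by (simp flip: add_divide_distrib)
  finally have "S (\<lambda>i. f i + g i) powr (1 / p) \<le> ((A + B) powr p) powr (1 / p)"
    using p S_nonneg by (intro powr_mono2) auto
  also have "\<dots> = A + B"
    using p A B by (simp add: powr_powr)
  also have "\<dots> = S f powr (1 / p) + S g powr (1 / p) + e"
    by (simp add: A_def B_def)
  finally show "(\<Sum>i\<in>I. w i * \<bar>f i + g i\<bar> powr p) powr (1 / p)
      \<le> (\<Sum>i\<in>I. w i * \<bar>f i\<bar> powr p) powr (1 / p) + (\<Sum>i\<in>I. w i * \<bar>g i\<bar> powr p) powr (1 / p) + e"
    by (simp add: S_def)
qed

section \<open>The symmetric integral as a finite weighted sum\<close>

lemma forward_integral_eq_sum:
  assumes "forward_integrable \<alpha> h a b" and b: "b = a + real m * \<alpha>"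
  shows "forward_integral \<alpha> h a b = \<alpha> * (\<Sum>k<m. h (a + real k * \<alpha>))"
proof -
  have "summable (\<lambda>k. h (a + real k * \<alpha>))"
    using assms(1) by (simp add: forward_integrable_def)
  moreover have "b + real k * \<alpha> = a + real (k + m) * \<alpha>" for k
    by (simp add: b algebra_simps)
  ultimately show ?thesis
    using suminf_split_initial_segment[of "\<lambda>k. h (a + real k * \<alpha>)" m]
    by (simp add: forward_integral_def forward_tail_def flip: right_diff_distrib)
qed

lemma backward_integral_eq_forward_integral_reflected:
  "backward_integral \<beta> h a b = forward_integral \<beta> (\<lambda>t. h (- t)) (- b) (- a)"
  by (simp add: backward_integral_def backward_tail_def forward_integral_def forward_tail_def)

lemma backward_integrable_iff_forward_integrable_reflected:
  "backward_integrable \<beta> h a b \<longleftrightarrow> forward_integrable \<beta> (\<lambda>t. h (- t)) (- b) (- a)"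
  by (auto simp: backward_integrable_def forward_integrable_def)

lemma backward_integral_eq_sum:
  assumes "backward_integrable \<beta> h a b" and "a = b - real n * \<beta>"
  shows "backward_integral \<beta> h a b = \<beta> * (\<Sum>k<n. h (b - real k * \<beta>))"
  using forward_integral_eq_sum[of \<beta> "\<lambda>t. h (- t)" "- b" "- a" n] assms
  by (simp add: backward_integral_eq_forward_integral_reflected
      backward_integrable_iff_forward_integrable_reflected)

text \<open>
  The forward and the backward nodes are indexed by a disjoint sum, since the two progressions may
  share points.
\<close>

lemma symmetric_integral_eq_weighted_sum:
  assumes "symmetric_integrable \<alpha> \<beta> h a b"
    and "b = a + real m * \<alpha>" and "a = b - real n * \<beta>"
  shows "symmetric_integral \<alpha> \<beta> h a b =
    (\<Sum>i\<in>{..<m} <+> {..<n}. case_sum (\<lambda>_. \<alpha>\<^sup>2 / (\<alpha> + \<beta>)) (\<lambda>_. \<beta>\<^sup>2 / (\<alpha> + \<beta>)) i *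
       h (case_sum (\<lambda>k. a + real k * \<alpha>) (\<lambda>k. b - real k * \<beta>) i))"
proof -
  have "\<alpha> / (\<alpha> + \<beta>) * forward_integral \<alpha> h a b =
      \<alpha>\<^sup>2 / (\<alpha> + \<beta>) * (\<Sum>k<m. h (a + real k * \<alpha>))"
    using assms(1) forward_integral_eq_sum[OF _ assms(2), of h]
    by (cases "\<alpha> = 0") (auto simp: symmetric_integrable_def power2_eq_square)
  moreover have "\<beta> / (\<alpha> + \<beta>) * backward_integral \<beta> h a b =
      \<beta>\<^sup>2 / (\<alpha> + \<beta>) * (\<Sum>k<n. h (b - real k * \<beta>))"
    using assms(1) backward_integral_eq_sum[OF _ assms(3), of h]
    by (cases "\<beta> = 0") (auto simp: symmetric_integrable_def power2_eq_square)
  ultimately show ?thesis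
    by (simp add: symmetric_integral_def sum.Plus sum_distrib_left)
qed

section \<open>Integrability of the power of a sum\<close>

text \<open>The sum of two numbers is at most twice the larger one, whence the constant.\<close>

lemma abs_add_powr_le:
  fixes u v p :: real
  assumes "p \<ge> 0"
  shows "\<bar>u + v\<bar> powr p \<le> 2 powr p * (\<bar>u\<bar> powr p + \<bar>v\<bar> powr p)"
proof -
  have "\<bar>u + v\<bar> powr p \<le> (2 * max \<bar>u\<bar> \<bar>v\<bar>) powr p"
    using assms by (intro powr_mono2) auto
  also have "\<dots> = 2 powr p * max \<bar>u\<bar> \<bar>v\<bar> powr p"
    by (simp add: powr_mult)
  also have "\<dots> \<le> 2 powr p * (\<bar>u\<bar> powr p + \<bar>v\<bar> powr p)"
    by (intro mult_left_mono) (auto simp: max_def)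
  finally show ?thesis .
qed

lemma summable_abs_add_powr:
  fixes u v :: "nat \<Rightarrow> real"
  assumes "p \<ge> 0" "summable (\<lambda>k. \<bar>u k\<bar> powr p)" "summable (\<lambda>k. \<bar>v k\<bar> powr p)"
  shows "summable (\<lambda>k. \<bar>u k + v k\<bar> powr p)"
proof (rule summable_comparison_test')
  show "summable (\<lambda>k. 2 powr p * (\<bar>u k\<bar> powr p + \<bar>v k\<bar> powr p))"
    using assms by (intro summable_mult summable_add)
  show "norm (\<bar>u k + v k\<bar> powr p) \<le> 2 powr p * (\<bar>u k\<bar> powr p + \<bar>v k\<bar> powr p)" if "k \<ge> 0" for k
    using abs_add_powr_le[OF assms(1)] by simp
qed

lemma symmetric_integrable_abs_add_powr:
  assumes "p \<ge> 0"
    and "symmetric_integrable \<alpha> \<beta> (\<lambda>t. \<bar>f t\<bar> powr p) a b"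
    and "symmetric_integrable \<alpha> \<beta> (\<lambda>t. \<bar>g t\<bar> powr p) a b"
  shows "symmetric_integrable \<alpha> \<beta> (\<lambda>t. \<bar>f t + g t\<bar> powr p) a b"
  using assms
  by (auto simp: symmetric_integrable_def forward_integrable_def backward_integrable_def
      intro: summable_abs_add_powr)

section \<open>Minkowski's inequality for the symmetric integral\<close>

theorem theorem11:
  fixes \<alpha> \<beta> a b p :: real and f g :: "real \<Rightarrow> real"
  assumes "\<alpha> \<ge> 0" and "\<beta> \<ge> 0" and "\<alpha> + \<beta> \<noteq> 0"
    and "a < b" and "p > 1"
    and "b \<in> {a + real k * \<alpha> | k :: nat. True}"
    and "a \<in> {b - real k * \<beta> | k :: nat. True}"
    and "symmetric_integrable \<alpha> \<beta> f a b"
    and "symmetric_integrable \<alpha> \<beta> g a b"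
    and "symmetric_integrable \<alpha> \<beta> (\<lambda>t. \<bar>f t\<bar> powr p) a b"
    and "symmetric_integrable \<alpha> \<beta> (\<lambda>t. \<bar>g t\<bar> powr p) a b"
  shows "symmetric_integrable \<alpha> \<beta> (\<lambda>t. \<bar>f t + g t\<bar> powr p) a b \<and>
    symmetric_integral \<alpha> \<beta> (\<lambda>t. \<bar>f t + g t\<bar> powr p) a b powr (1 / p)
      \<le> symmetric_integral \<alpha> \<beta> (\<lambda>t. \<bar>f t\<bar> powr p) a b powr (1 / p)
        + symmetric_integral \<alpha> \<beta> (\<lambda>t. \<bar>g t\<bar> powr p) a b powr (1 / p)"
proof -
  obtain m n where m: "b = a + real m * \<alpha>" and n: "a = b - real n * \<beta>"
    using assms(6,7) by auto
  have fg: "symmetric_integrable \<alpha> \<beta> (\<lambda>t. \<bar>f t + g t\<bar> powr p) a b"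
    using assms(5,10,11) by (intro symmetric_integrable_abs_add_powr) auto
  define I where "I = {..<m} <+> {..<n}"
  define w where "w = case_sum (\<lambda>_::nat. \<alpha>\<^sup>2 / (\<alpha> + \<beta>)) (\<lambda>_::nat. \<beta>\<^sup>2 / (\<alpha> + \<beta>))"
  define x where "x = case_sum (\<lambda>k. a + real k * \<alpha>) (\<lambda>k. b - real k * \<beta>)"
  have integral_eq: "symmetric_integral \<alpha> \<beta> h a b = (\<Sum>i\<in>I. w i * h (x i))"
    if "symmetric_integrable \<alpha> \<beta> h a b" for h
    using symmetric_integral_eq_weighted_sum[OF that m n] by (simp add: I_def w_def x_def)
  have "w i \<ge> 0" for i
    using assms(1,2) by (cases i) (auto simp: w_def)
  then show ?thesis
    using fg weighted_sum_Minkowski[of p I w "\<lambda>i. f (x i)" "\<lambda>i. g (x i)"] assms(5)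
    by (simp add: integral_eq fg assms(10,11))
qed

end
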